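(* Let $f\colon P\twoheadrightarrow Q$ be an operator-reduced quandle homomorphism. Suppose that $P$ satisfies either the condition that $\mathrm{Inn}(P)$ is generated by finitely many symmetry maps $s_x$ ($x\in P$), or the condition that $P$ has finitely many connected components. If $\mathrm{Inn}_{\mathrm{rel}}(f)$ is nilpotent (as an abstract group) and $\mathrm{Inn}(Q)$ is abelian, then $f$ is nilpotent.
   Context: A quandle is a set $Q$ with a map (symmetry map) $s_x\colon Q\to Q$ for each $x\in Q$ such that, for all $x,y\in Q$, $s_x(x)=x$, $s_x$ is bijective, and $s_x\circ s_y=s_{s_x(y)}\circ s_x$. A quandle homomorphism is a map $f\colon P\to Q$ with $f\circ s_x=s_{f(x)}\circ f$ for all $x\in P$. The inner automorphism group $\mathrm{Inn}(Q)$ is the subgroup of $\mathrm{Aut}(Q)$ generated by all $s_x$. The connected components of $Q$ are the orbits of $\mathrm{Inn}(Q)$ acting on $Q$. For a surjective quandle homomorphism $f\colon P\twoheadrightarrow Q$ there is a unique surjective group homomorphism $f_*\colon\mathrm{Inn}(P)\to\mathrm{Inn}(Q)$ with $f_*(s_x)=s_{f(x)}$; put $\mathrm{Inn}_{\mathrm{rel}}(f)=\mathrm{Ker}(f_* )$. For subgroups $A,B$ of a group, $[A,B]$ is the subgroup generated by all $[a,b]=aba^{-1}b^{-1}$. For $N\trianglelefteq G$ put $\Gamma_0(G,N)=N$, $\Gamma_{i+1}(G,N)=[G,\Gamma_i(G,N)]$. The surjective homomorphism $f$ is nilpotent if $\Gamma_c(\mathrm{Inn}(P),\mathrm{Inn}_{\mathrm{rel}}(f))=1$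 for some integer $c\ge0$. A surjective quandle homomorphism $f$ is operator-reduced if $s_xs_{\varphi(x)}=s_{\varphi(x)}s_x$ for every $x\in P$ and every $\varphi\in\mathrm{Inn}_{\mathrm{rel}}(f)$. *)

theory Defs
  imports "HOL-Algebra.Algebra"
begin

section \<open>Quandles\<close>

record 'a quandle = "'a partial_object" +
  symm :: "'a \<Rightarrow> 'a \<Rightarrow> 'a"

locale quandle =
  fixes Q :: "('a, 'q) quandle_scheme" (structure)
  assumes symm_self: "x \<in> carrier Q \<Longrightarrow> symm Q x x = x"
    and symm_bij: "x \<in> carrier Q \<Longrightarrow> bij_betw (symm Q x) (carrier Q) (carrier Q)"
    and symm_symm: "\<lbrakk>x \<in> carrier Q; y \<in> carrier Q; z \<in> carrier Q\<rbrakk> \<Longrightarrow>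
      symm Q x (symm Q y z) = symm Q (symm Q x y) (symm Q x z)"

definition quandle_hom :: "('a, 'p) quandle_scheme \<Rightarrow> ('b, 'q) quandle_scheme \<Rightarrow> ('a \<Rightarrow> 'b) set" where
  "quandle_hom P Q = {f \<in> carrier P \<rightarrow> carrier Q.
     \<forall>x\<in>carrier P. \<forall>y\<in>carrier P. f (symm P x y) = symm Q (f x) (f y)}"

definition quandle_epi :: "('a, 'p) quandle_scheme \<Rightarrow> ('b, 'q) quandle_scheme \<Rightarrow> ('a \<Rightarrow> 'b) set" where
  "quandle_epi P Q = {f \<in> quandle_hom P Q. f ` carrier P = carrier Q}"


section \<open>Automorphisms and inner automorphisms\<close>

text \<open>As in \<^theory>\<open>HOL-Algebra.Bij\<close>, self-maps are extensional functions on the carrier,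
  and multiplication is composition.\<close>

definition quandle_Aut :: "('a, 'q) quandle_scheme \<Rightarrow> ('a \<Rightarrow> 'a) monoid" where
  "quandle_Aut Q = BijGroup (carrier Q)\<lparr>carrier := quandle_hom Q Q \<inter> Bij (carrier Q)\<rparr>"

definition sym_map :: "('a, 'q) quandle_scheme \<Rightarrow> 'a \<Rightarrow> ('a \<Rightarrow> 'a)" where
  "sym_map Q x = restrict (symm Q x) (carrier Q)"

definition Inn :: "('a, 'q) quandle_scheme \<Rightarrow> ('a \<Rightarrow> 'a) monoid" where
  "Inn Q = subgroup_generated (quandle_Aut Q) (sym_map Q ` carrier Q)"

definition connected_components :: "('a, 'q) quandle_scheme \<Rightarrow> 'a set set" where
  "connected_components Q = orbits (Inn Q) (carrier Q) (\<lambda>\<phi>. \<phi>)"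

text \<open>The homomorphism \<open>f\<^sub>*\<close>; extensionality makes it unique as a HOL function.\<close>

definition Inn_map ::
    "('a, 'p) quandle_scheme \<Rightarrow> ('b, 'q) quandle_scheme \<Rightarrow> ('a \<Rightarrow> 'b) \<Rightarrow> ('a \<Rightarrow> 'a) \<Rightarrow> ('b \<Rightarrow> 'b)" where
  "Inn_map P Q f = (THE h. h \<in> hom (Inn P) (Inn Q) \<and> h \<in> extensional (carrier (Inn P)) \<and>
     (\<forall>x\<in>carrier P. h (sym_map P x) = sym_map Q (f x)))"

definition Inn_rel ::
    "('a, 'p) quandle_scheme \<Rightarrow> ('b, 'q) quandle_scheme \<Rightarrow> ('a \<Rightarrow> 'b) \<Rightarrow> ('a \<Rightarrow> 'a) set" where
  "Inn_rel P Q f = kernel (Inn P) (Inn Q) (Inn_map P Q f)"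


section \<open>Nilpotency\<close>

definition commutator_subgroup :: "('g, 'm) monoid_scheme \<Rightarrow> 'g set \<Rightarrow> 'g set \<Rightarrow> 'g set" where
  "commutator_subgroup G A B =
     generate G {a \<otimes>\<^bsub>G\<^esub> b \<otimes>\<^bsub>G\<^esub> inv\<^bsub>G\<^esub> a \<otimes>\<^bsub>G\<^esub> inv\<^bsub>G\<^esub> b | a b. a \<in> A \<and> b \<in> B}"

primrec rel_lower_central :: "('g, 'm) monoid_scheme \<Rightarrow> 'g set \<Rightarrow> nat \<Rightarrow> 'g set" where
  "rel_lower_central G N 0 = N"
| "rel_lower_central G N (Suc i) = commutator_subgroup G (carrier G) (rel_lower_central G N i)"

definition nilpotent_group :: "('g, 'm) monoid_scheme \<Rightarrow> bool" where
  "nilpotent_group G \<longleftrightarrow> group G \<and> (\<exists>c. rel_lower_central G (carrier G) c = {\<one>\<^bsub>G\<^esub>})"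

definition nilpotent_quandle_hom ::
    "('a, 'p) quandle_scheme \<Rightarrow> ('b, 'q) quandle_scheme \<Rightarrow> ('a \<Rightarrow> 'b) \<Rightarrow> bool" where
  "nilpotent_quandle_hom P Q f \<longleftrightarrow> f \<in> quandle_epi P Q \<and>
     (\<exists>c. rel_lower_central (Inn P) (Inn_rel P Q f) c = {\<one>\<^bsub>Inn P\<^esub>})"

definition operator_reduced ::
    "('a, 'p) quandle_scheme \<Rightarrow> ('b, 'q) quandle_scheme \<Rightarrow> ('a \<Rightarrow> 'b) \<Rightarrow> bool" where
  "operator_reduced P Q f \<longleftrightarrow> f \<in> quandle_epi P Q \<and>
     (\<forall>x\<in>carrier P. \<forall>\<phi>\<in>Inn_rel P Q f.
        sym_map P x \<otimes>\<^bsub>Inn P\<^esub> sym_map P (\<phi> x) = sym_map P (\<phi> x) \<otimes>\<^bsub>Inn P\<^esub> sym_map P x)"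


section \<open>Well-definedness\<close>

lemma (in quandle) symm_closed:
  "\<lbrakk>x \<in> carrier Q; y \<in> carrier Q\<rbrakk> \<Longrightarrow> symm Q x y \<in> carrier Q"
  using symm_bij bij_betwE by blast

lemma (in quandle) subgroup_Aut:
  "subgroup (quandle_hom Q Q \<inter> Bij (carrier Q)) (BijGroup (carrier Q))"
proof (rule subgroup.intro)
  show "quandle_hom Q Q \<inter> Bij (carrier Q) \<subseteq> carrier (BijGroup (carrier Q))"
    by (simp add: BijGroup_def)
next
  fix x y
  assume "x \<in> quandle_hom Q Q \<inter> Bij (carrier Q)" "y \<in> quandle_hom Q Q \<inter> Bij (carrier Q)"
  then show "x \<otimes>\<^bsub>BijGroup (carrier Q)\<^esub> y \<in> quandle_hom Q Q \<inter> Bij (carrier Q)"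
    by (auto simp: BijGroup_def compose_Bij quandle_hom_def compose_eq symm_closed Pi_iff)
next
  show "\<one>\<^bsub>BijGroup (carrier Q)\<^esub> \<in> quandle_hom Q Q \<inter> Bij (carrier Q)"
    by (auto simp: BijGroup_def id_Bij quandle_hom_def symm_closed)
next
  fix x
  assume x: "x \<in> quandle_hom Q Q \<inter> Bij (carrier Q)"
  then have b: "x \<in> Bij (carrier Q)"
    and h: "\<And>a b. \<lbrakk>a \<in> carrier Q; b \<in> carrier Q\<rbrakk> \<Longrightarrow> x (symm Q a b) = symm Q (x a) (x b)"
    by (auto simp: quandle_hom_def)
  have "inv_into (carrier Q) x (symm Q a c)
      = symm Q (inv_into (carrier Q) x a) (inv_into (carrier Q) x c)"
    if "a \<in> carrier Q" "c \<in> carrier Q" for a c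
    by (rule Bij_inv_into_lemma[where g = "symm Q"]) (use b h that symm_closed in auto)
  then show "inv\<^bsub>BijGroup (carrier Q)\<^esub> x \<in> quandle_hom Q Q \<inter> Bij (carrier Q)"
    using b by (auto simp: inv_BijGroup restrict_inv_into_Bij quandle_hom_def
        Bij_inv_into_mem symm_closed)
qed

lemma (in quandle) group_Aut: "group (quandle_Aut Q)"
  unfolding quandle_Aut_def
  by (rule subgroup.subgroup_is_group[OF subgroup_Aut group_BijGroup])

lemma (in quandle) sym_map_Aut: "x \<in> carrier Q \<Longrightarrow> sym_map Q x \<in> carrier (quandle_Aut Q)"
proof -
  assume x: "x \<in> carrier Q"
  have "bij_betw (sym_map Q x) (carrier Q) (carrier Q)"
    using symm_bij[OF x] by (simp add: sym_map_def bij_betw_restrict_eq)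
  moreover have "sym_map Q x \<in> quandle_hom Q Q"
    using x symm_closed by (auto simp: sym_map_def quandle_hom_def intro!: symm_symm)
  ultimately show ?thesis by (simp add: quandle_Aut_def Bij_def) (simp add: sym_map_def)
qed

lemma (in quandle) group_Inn: "group (Inn Q)"
  unfolding Inn_def by (rule group.group_subgroup_generated[OF group_Aut])

lemma (in quandle) carrier_Inn:
  "carrier (Inn Q) = generate (quandle_Aut Q) (sym_map Q ` carrier Q)"
proof -
  have "carrier (quandle_Aut Q) \<inter> sym_map Q ` carrier Q = sym_map Q ` carrier Q"
    using sym_map_Aut by blast
  then show ?thesis by (simp add: Inn_def carrier_subgroup_generated)
qed

lemma (in quandle) Inn_sub_Aut: "carrier (Inn Q) \<subseteq> carrier (quandle_Aut Q)"
  by (metis group_Aut Inn_def group.carrier_subgroup_generated_subset)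

lemma (in quandle) sym_map_Inn: "x \<in> carrier Q \<Longrightarrow> sym_map Q x \<in> carrier (Inn Q)"
  by (auto simp: carrier_Inn intro: generate.incl)

lemma (in quandle) Inn_Bij: "\<phi> \<in> carrier (Inn Q) \<Longrightarrow> \<phi> \<in> Bij (carrier Q)"
  using Inn_sub_Aut by (auto simp: quandle_Aut_def)

lemma (in quandle) Inn_mult:
  "\<lbrakk>\<phi> \<in> carrier (Inn Q); \<psi> \<in> carrier (Inn Q)\<rbrakk> \<Longrightarrow> \<phi> \<otimes>\<^bsub>Inn Q\<^esub> \<psi> = compose (carrier Q) \<phi> \<psi>"
  using Inn_Bij[of \<phi>] Inn_Bij[of \<psi>]
  by (simp add: Inn_def subgroup_generated_def quandle_Aut_def BijGroup_def)

lemma (in quandle) Inn_one: "\<one>\<^bsub>Inn Q\<^esub> = (\<lambda>x\<in>carrier Q. x)"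
  by (simp add: Inn_def subgroup_generated_def quandle_Aut_def BijGroup_def)

lemma (in quandle) Inn_generate: "carrier (Inn Q) = generate (Inn Q) (sym_map Q ` carrier Q)"
proof -
  interpret A: group "quandle_Aut Q" by (rule group_Aut)
  let ?H = "sym_map Q ` carrier Q"
  have "generate (quandle_Aut Q\<lparr>carrier := generate (quandle_Aut Q) ?H\<rparr>) ?H = generate (quandle_Aut Q) ?H"
  proof (rule A.generate_consistent)
    show "?H \<subseteq> generate (quandle_Aut Q) ?H" by (blast intro: generate.incl)
    show "subgroup (generate (quandle_Aut Q) ?H) (quandle_Aut Q)"
      by (rule A.generate_is_subgroup) (use sym_map_Aut in blast)
  qed
  moreover have "Inn Q = quandle_Aut Q\<lparr>carrier := generate (quandle_Aut Q) ?H\<rparr>"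
    using carrier_Inn by (simp add: Inn_def subgroup_generated_def)
  ultimately show ?thesis by simp
qed

lemma Inn_lift:
  assumes P: "quandle P" and Q: "quandle Q" and f: "f \<in> quandle_epi P Q"
    and "\<phi> \<in> carrier (Inn P)"
  shows "\<exists>\<psi>\<in>carrier (Inn Q). \<forall>x\<in>carrier P. \<psi> (f x) = f (\<phi> x)"
proof -
  interpret P: quandle P by fact
  interpret Q: quandle Q by fact
  interpret IP: group "Inn P" by (rule P.group_Inn)
  interpret IQ: group "Inn Q" by (rule Q.group_Inn)
  have fc: "f x \<in> carrier Q" if "x \<in> carrier P" for x
    using f that by (auto simp: quandle_epi_def quandle_hom_def)
  have fs: "f (symm P x y) = symm Q (f x) (f y)" if "x \<in> carrier P" "y \<in> carrier P" for x y
    using f that by (auto simp: quandle_epi_def quandle_hom_def)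
  have gen: "generate (Inn P) (sym_map P ` carrier P) = carrier (Inn P)"
    using P.Inn_generate by simp
  have "\<phi> \<in> generate (Inn P) (sym_map P ` carrier P)"
    using assms gen by simp
  then show ?thesis
  proof (induction rule: generate.induct)
    case one
    show ?case
      by (rule bexI[OF _ IQ.one_closed]) (simp add: P.Inn_one Q.Inn_one fc)
  next
    case (incl h)
    then obtain x where x: "x \<in> carrier P" "h = sym_map P x" by auto
    then show ?case
      by (intro bexI[OF _ Q.sym_map_Inn[OF fc[OF x(1)]]]) (simp add: sym_map_def fc fs)
  next
    case (inv h)
    then obtain x where x: "x \<in> carrier P" "h = sym_map P x" by auto
    let ?i = "inv\<^bsub>Inn P\<^esub> h" and ?j = "inv\<^bsub>Inn Q\<^esub> (sym_map Q (f x))"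
    have hI: "h \<in> carrier (Inn P)" and kI: "sym_map Q (f x) \<in> carrier (Inn Q)"
      using x P.sym_map_Inn Q.sym_map_Inn fc by auto
    have "?j (f y) = f (?i y)" if y: "y \<in> carrier P" for y
    proof -
      have iy: "?i y \<in> carrier P"
        using P.Inn_Bij[OF IP.inv_closed[OF hI]] y Bij_imp_funcset by fastforce
      have "compose (carrier P) h ?i = (\<lambda>x\<in>carrier P. x)"
        using IP.r_inv[OF hI] P.Inn_mult[OF hI IP.inv_closed[OF hI]] P.Inn_one by simp
      then have "h (?i y) = y" using y by (metis compose_eq restrict_apply')
      then have "f y = sym_map Q (f x) (f (?i y))"
        using x iy fs fc by (metis restrict_apply' sym_map_def)
      moreover have "compose (carrier Q) ?j (sym_map Q (f x)) = (\<lambda>x\<in>carrier Q. x)"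
        using IQ.l_inv[OF kI] Q.Inn_mult[OF IQ.inv_closed[OF kI] kI] Q.Inn_one by simp
      ultimately show ?thesis
        using fc[OF iy] by (metis compose_eq restrict_apply')
    qed
    then show ?case using IQ.inv_closed[OF kI] by blast
  next
    case (eng h1 h2)
    then obtain k1 k2 where k: "k1 \<in> carrier (Inn Q)" "\<And>x. x \<in> carrier P \<Longrightarrow> k1 (f x) = f (h1 x)"
      "k2 \<in> carrier (Inn Q)" "\<And>x. x \<in> carrier P \<Longrightarrow> k2 (f x) = f (h2 x)" by blast
    have h: "h1 \<in> carrier (Inn P)" "h2 \<in> carrier (Inn P)" using eng gen by auto
    have "h2 x \<in> carrier P" if "x \<in> carrier P" for x
      using P.Inn_Bij[OF h(2)] that Bij_imp_funcset by fastforce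
    then show ?case
      by (intro bexI[OF _ IQ.m_closed[OF k(1,3)]])
        (simp add: P.Inn_mult[OF h] Q.Inn_mult[OF k(1,3)] compose_eq fc k)
  qed
qed

lemma Inn_map_ex1:
  assumes P: "quandle P" and Q: "quandle Q" and f: "f \<in> quandle_epi P Q"
  shows "\<exists>!h. h \<in> hom (Inn P) (Inn Q) \<and> h \<in> extensional (carrier (Inn P)) \<and>
     (\<forall>x\<in>carrier P. h (sym_map P x) = sym_map Q (f x))"
proof -
  interpret P: quandle P by fact
  interpret Q: quandle Q by fact
  interpret IP: group "Inn P" by (rule P.group_Inn)
  interpret IQ: group "Inn Q" by (rule Q.group_Inn)
  have fc: "f x \<in> carrier Q" if "x \<in> carrier P" for x
    using f that by (auto simp: quandle_epi_def quandle_hom_def)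
  have fs: "f (symm P x y) = symm Q (f x) (f y)" if "x \<in> carrier P" "y \<in> carrier P" for x y
    using f that by (auto simp: quandle_epi_def quandle_hom_def)
  have surj: "f ` carrier P = carrier Q" using f by (simp add: quandle_epi_def)
  have gen: "generate (Inn P) (sym_map P ` carrier P) = carrier (Inn P)"
    using P.Inn_generate by simp
  have uniq: "\<psi> = \<psi>'" if "\<psi> \<in> carrier (Inn Q)" "\<psi>' \<in> carrier (Inn Q)"
    "\<And>x. x \<in> carrier P \<Longrightarrow> \<psi> (f x) = \<psi>' (f x)" for \<psi> \<psi>'
  proof (rule extensionalityI[of _ "carrier Q"])
    show "\<psi> \<in> extensional (carrier Q)" "\<psi>' \<in> extensional (carrier Q)"
      using that Q.Inn_Bij Bij_imp_extensional by auto
    show "\<psi> y = \<psi>' y" if "y \<in> carrier Q" for y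
      proof -
      obtain x where "x \<in> carrier P" "y = f x" using surj \<open>y \<in> carrier Q\<close> by blast
      then show ?thesis using \<open>\<And>x. x \<in> carrier P \<Longrightarrow> \<psi> (f x) = \<psi>' (f x)\<close> by blast
    qed
  qed
  obtain g where g: "\<And>\<phi>. \<phi> \<in> carrier (Inn P) \<Longrightarrow>
      g \<phi> \<in> carrier (Inn Q) \<and> (\<forall>x\<in>carrier P. g \<phi> (f x) = f (\<phi> x))"
    using Inn_lift[OF P Q f] by metis
  define h where "h = restrict g (carrier (Inn P))"
  have hh: "h \<phi> \<in> carrier (Inn Q)" "\<And>x. x \<in> carrier P \<Longrightarrow> h \<phi> (f x) = f (\<phi> x)"
    if "\<phi> \<in> carrier (Inn P)" for \<phi> using g that by (auto simp: h_def)
  show ?thesis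
  proof (rule ex1I[of _ h], intro conjI ballI)
    show "h \<in> hom (Inn P) (Inn Q)"
    proof (rule homI)
      fix a b assume ab: "a \<in> carrier (Inn P)" "b \<in> carrier (Inn P)"
      have bc: "b x \<in> carrier P" if "x \<in> carrier P" for x
        using P.Inn_Bij[OF ab(2)] that Bij_imp_funcset by fastforce
      show "h (a \<otimes>\<^bsub>Inn P\<^esub> b) = h a \<otimes>\<^bsub>Inn Q\<^esub> h b"
      proof (rule uniq)
        fix x assume x: "x \<in> carrier P"
        have "h (a \<otimes>\<^bsub>Inn P\<^esub> b) (f x) = f ((a \<otimes>\<^bsub>Inn P\<^esub> b) x)"
          by (rule hh(2)) (use ab x in auto)
        also have "\<dots> = f (a (b x))" by (simp add: P.Inn_mult[OF ab] compose_eq x)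
        also have "\<dots> = (h a \<otimes>\<^bsub>Inn Q\<^esub> h b) (f x)"
          by (simp add: Q.Inn_mult hh ab compose_eq fc x bc)
        finally show "h (a \<otimes>\<^bsub>Inn P\<^esub> b) (f x) = (h a \<otimes>\<^bsub>Inn Q\<^esub> h b) (f x)" .
      qed (use ab hh in auto)
    qed (use hh in auto)
    show "h \<in> extensional (carrier (Inn P))" by (simp add: h_def)
    show "h (sym_map P x) = sym_map Q (f x)" if "x \<in> carrier P" for x
      by (rule uniq) (use that hh P.sym_map_Inn Q.sym_map_Inn fc fs in \<open>auto simp: sym_map_def\<close>)
  next
    fix k assume k: "k \<in> hom (Inn P) (Inn Q) \<and> k \<in> extensional (carrier (Inn P)) \<and>
      (\<forall>x\<in>carrier P. k (sym_map P x) = sym_map Q (f x))"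
    interpret K: group_hom "Inn P" "Inn Q" k
      by unfold_locales (use k in auto)
    have *: "\<forall>x\<in>carrier P. k \<phi> (f x) = f (\<phi> x)" if "\<phi> \<in> generate (Inn P) (sym_map P ` carrier P)" for \<phi>
      using that
    proof (induction rule: generate.induct)
      case one
      show ?case by (simp only: K.hom_one) (simp add: P.Inn_one Q.Inn_one fc)
    next
      case (incl a)
      then obtain x where x: "x \<in> carrier P" "a = sym_map P x" by auto
      then have ka: "k a = sym_map Q (f x)" using k by blast
      show ?case unfolding ka using x by (simp add: sym_map_def fc fs)
    next
      case (inv a)
      then obtain x where x: "x \<in> carrier P" "a = sym_map P x" by auto
      have a: "a \<in> carrier (Inn P)" using x P.sym_map_Inn by auto
      let ?i = "inv\<^bsub>Inn P\<^esub> a"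
      have i: "?i \<in> carrier (Inn P)" using a by simp
      show ?case
      proof
        fix y assume y: "y \<in> carrier P"
        have iy: "?i y \<in> carrier P"
          using P.Inn_Bij[OF i] y Bij_imp_funcset by fastforce
        have "compose (carrier P) a ?i = (\<lambda>x\<in>carrier P. x)"
          using IP.r_inv[OF a] P.Inn_mult[OF a i] P.Inn_one by simp
        then have "a (?i y) = y" using y by (metis compose_eq restrict_apply')
        then have "f y = k a (f (?i y))"
          using k x iy fs fc by (metis restrict_apply' sym_map_def)
        moreover have "compose (carrier Q) (k ?i) (k a) = (\<lambda>x\<in>carrier Q. x)"
          using K.hom_mult[OF i a] IP.l_inv[OF a] K.hom_one Q.Inn_one
            Q.Inn_mult[OF K.hom_closed[OF i] K.hom_closed[OF a]] by simp
        ultimately show "k ?i (f y) = f (?i y)"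
          using fc[OF iy] by (metis compose_eq restrict_apply')
      qed
    next
      case (eng a b)
      have ab: "a \<in> carrier (Inn P)" "b \<in> carrier (Inn P)" using eng gen by auto
      have "b x \<in> carrier P" if "x \<in> carrier P" for x
        using P.Inn_Bij[OF ab(2)] that Bij_imp_funcset by fastforce
      then show ?case unfolding K.hom_mult[OF ab] using eng.IH
        by (simp add: P.Inn_mult[OF ab] compose_eq fc
            Q.Inn_mult[OF K.hom_closed[OF ab(1)] K.hom_closed[OF ab(2)]])
    qed
    show "k = h"
    proof (rule extensionalityI[of _ "carrier (Inn P)"])
      show "k \<phi> = h \<phi>" if "\<phi> \<in> carrier (Inn P)" for \<phi>
        by (rule uniq) (use that * gen hh in auto)
    qed (use k in \<open>auto simp: h_def\<close>)
  qed
qed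

lemma Inn_map:
  assumes "quandle P" "quandle Q" "f \<in> quandle_epi P Q"
  shows "Inn_map P Q f \<in> hom (Inn P) (Inn Q)"
    and "\<And>x. x \<in> carrier P \<Longrightarrow> Inn_map P Q f (sym_map P x) = sym_map Q (f x)"
  using theI'[OF Inn_map_ex1[OF assms]] by (auto simp: Inn_map_def)

lemma Inn_map_surj:
  assumes P: "quandle P" and Q: "quandle Q" and f: "f \<in> quandle_epi P Q"
  shows "Inn_map P Q f ` carrier (Inn P) = carrier (Inn Q)"
proof -
  interpret P: quandle P by fact
  interpret Q: quandle Q by fact
  interpret group_hom "Inn P" "Inn Q" "Inn_map P Q f"
    by (intro group_hom.intro group_hom_axioms.intro P.group_Inn Q.group_Inn Inn_map(1) assms)
  have surj: "f ` carrier P = carrier Q" using f by (simp add: quandle_epi_def)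
  have sub: "sym_map P ` carrier P \<subseteq> carrier (Inn P)" using P.sym_map_Inn by auto
  have "Inn_map P Q f ` sym_map P ` carrier P = sym_map Q ` f ` carrier P"
    using Inn_map(2)[OF assms] by (simp add: image_image)
  then show ?thesis
    using generate_img[OF sub] P.Inn_generate Q.Inn_generate surj by simp
qed

end

theory Submission
  imports Defs
begin

text \<open>Write \<open>G = Inn P\<close> and \<open>N = Inn_rel f\<close>. Since \<open>\<phi> s\<^sub>x \<phi>\<inverse> = s\<^bsub>\<phi>(x)\<^esub>\<close>, operator-reducedness says
  that \<open>[s\<^sub>x, [s\<^sub>x, n]] = 1\<close> for \<open>n \<in> N\<close>, so each \<open>s\<^sub>x\<close> acts on \<open>N/[N, N]\<close> with \<open>(s\<^sub>x - 1)\<^sup>2 = 0\<close>.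
  As \<open>G/N\<close> is abelian, conjugate symmetry maps agree modulo \<open>N\<close>, so in both cases finitely many
  \<open>s\<^sub>x\<close> generate \<open>G\<close> modulo \<open>N\<close>, and their actions on \<open>N/[N, N]\<close> commute. Hence \<open>G\<close> acts
  nilpotently on \<open>N/[N, N]\<close>. By the three subgroups lemma it then acts nilpotently on each
  factor of the lower central series of \<open>N\<close>, which reaches \<open>1\<close>.\<close>

section \<open>Commutators modulo a normal subgroup\<close>

definition commutator :: "('g, 'm) monoid_scheme \<Rightarrow> 'g \<Rightarrow> 'g \<Rightarrow> 'g" where
  "commutator G x y = x \<otimes>\<^bsub>G\<^esub> y \<otimes>\<^bsub>G\<^esub> inv\<^bsub>G\<^esub> x \<otimes>\<^bsub>G\<^esub> inv\<^bsub>G\<^esub> y"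

text \<open>The preimage of the centre of \<open>G/K\<close>. The inclusion \<open>X \<subseteq> (center_mod G ^^ m) K\<close> expresses
  \<open>\<Gamma>\<^sub>m(G, X) \<subseteq> K\<close> as membership in a subgroup, so that it may be checked on generators of \<open>X\<close>.\<close>

definition center_mod :: "('g, 'm) monoid_scheme \<Rightarrow> 'g set \<Rightarrow> 'g set" where
  "center_mod G K = {g \<in> carrier G. \<forall>h\<in>carrier G. commutator G h g \<in> K}"

lemma commutator_subgroup_eq:
  "commutator_subgroup G A B = generate G {commutator G a b | a b. a \<in> A \<and> b \<in> B}"
  by (simp add: commutator_subgroup_def commutator_def)

context group
begin

lemma inv_cancel_left:
  "\<lbrakk>x \<in> carrier G; y \<in> carrier G\<rbrakk> \<Longrightarrow> x \<otimes> (inv x \<otimes> y) = y"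
  "\<lbrakk>x \<in> carrier G; y \<in> carrier G\<rbrakk> \<Longrightarrow> inv x \<otimes> (x \<otimes> y) = y"
  by (simp_all add: m_assoc[symmetric])

text \<open>Rewriting with these rules decides equality of words in the free group.\<close>

lemmas word_simps = commutator_def m_assoc inv_mult_group inv_cancel_left

lemma commutator_closed [simp]:
  "\<lbrakk>x \<in> carrier G; y \<in> carrier G\<rbrakk> \<Longrightarrow> commutator G x y \<in> carrier G"
  by (simp add: commutator_def)

lemma inv_commutator:
  "\<lbrakk>x \<in> carrier G; y \<in> carrier G\<rbrakk> \<Longrightarrow> inv (commutator G x y) = commutator G y x"
  by (simp add: word_simps)

lemma conj_commutator:
  "\<lbrakk>g \<in> carrier G; x \<in> carrier G; y \<in> carrier G\<rbrakk> \<Longrightarrow>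
    g \<otimes> commutator G x y \<otimes> inv g = commutator G (g \<otimes> x \<otimes> inv g) (g \<otimes> y \<otimes> inv g)"
  by (simp add: word_simps)

lemma commutator_swap_mem:
  assumes "subgroup K G" "x \<in> carrier G" "y \<in> carrier G" "commutator G x y \<in> K"
  shows "commutator G y x \<in> K"
  using assms subgroup.m_inv_closed[of K G "commutator G x y"] by (simp add: inv_commutator)

lemma normal_conj:
  "\<lbrakk>K \<lhd> G; g \<in> carrier G; x \<in> K\<rbrakk> \<Longrightarrow> g \<otimes> x \<otimes> inv g \<in> K"
  by (simp add: normal.inv_op_closed2)

lemma subset_carrier: "\<lbrakk>K \<lhd> G; x \<in> K\<rbrakk> \<Longrightarrow> x \<in> carrier G"
  by (meson normal_imp_subgroup subgroup.mem_carrier)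

lemma commutator_mem_right:
  assumes K: "K \<lhd> G" and "x \<in> carrier G" "y \<in> K"
  shows "commutator G x y \<in> K"
  using normal_conj[OF K, of x y] assms normal_imp_subgroup[OF K]
  by (simp add: commutator_def subgroup.m_closed subgroup.m_inv_closed)

lemma commutator_mem_left:
  assumes "K \<lhd> G" "x \<in> K" "y \<in> carrier G"
  shows "commutator G x y \<in> K"
  using assms commutator_mem_right commutator_swap_mem normal_imp_subgroup subset_carrier by metis

section \<open>Centralizers modulo a normal subgroup and iterated centers\<close>

text \<open>The set is the centralizer of \<open>n\<close> modulo \<open>K\<close>; being a
  subgroup, it can be tested on generators. Closure under products comes from
  \<open>[x y, n] = (x [y, n] x^-1) [x, n]\<close> and the normality of \<open>K\<close>.\<close>

lemma subgroup_commutator_left: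
  assumes K: "K \<lhd> G" and n: "n \<in> carrier G"
  shows "subgroup {g \<in> carrier G. commutator G g n \<in> K} G"
proof -
  interpret K: normal K G by fact
  show ?thesis
  proof (rule subgroup.intro)
    fix x y assume *: "x \<in> {g \<in> carrier G. commutator G g n \<in> K}"
      "y \<in> {g \<in> carrier G. commutator G g n \<in> K}"
    have "commutator G (x \<otimes> y) n = (x \<otimes> commutator G y n \<otimes> inv x) \<otimes> commutator G x n"
      using * n by (simp add: word_simps)
    then show "x \<otimes> y \<in> {g \<in> carrier G. commutator G g n \<in> K}"
      using * normal_conj[OF K] K.m_closed by simp
  next
    fix x assume *: "x \<in> {g \<in> carrier G. commutator G g n \<in> K}"
    have "commutator G (inv x) n = inv x \<otimes> inv (commutator G x n) \<otimes> inv (inv x)"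
      using * n by (simp add: word_simps)
    also have "\<dots> \<in> K" using * by (intro normal_conj[OF K]) auto
    finally show "inv x \<in> {g \<in> carrier G. commutator G g n \<in> K}" using * by simp
  qed (use n in \<open>auto simp: commutator_def\<close>)
qed

lemma subgroup_commutator_right:
  assumes K: "K \<lhd> G" and h: "h \<in> carrier G"
  shows "subgroup {x \<in> carrier G. commutator G h x \<in> K} G"
proof -
  have "{x \<in> carrier G. commutator G h x \<in> K} = {x \<in> carrier G. commutator G x h \<in> K}"
    using commutator_swap_mem[OF normal_imp_subgroup[OF K]] h by blast
  then show ?thesis using subgroup_commutator_left[OF K h] by simp
qed

text \<open>It is an intersection of centralizers modulo \<open>K\<close>. Conjugating
  \<open>x\<close> by \<open>g\<close> has, up to conjugation by \<open>g\<close>, the same effect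
  on \<open>[h, x]\<close> as conjugating \<open>h\<close> by \<open>g^-1\<close>, and
  \<open>h\<close> ranges over all of \<open>G\<close>.\<close>

lemma center_mod_normal:
  assumes K: "K \<lhd> G"
  shows "center_mod G K \<lhd> G"
proof -
  have "center_mod G K = (\<Inter>h\<in>carrier G. {x \<in> carrier G. commutator G h x \<in> K})"
    by (auto simp: center_mod_def)
  also have "subgroup \<dots> G"
    by (rule subgroups_Inter) (use subgroup_commutator_right[OF K] in auto)
  finally have "subgroup (center_mod G K) G" .
  moreover have "g \<otimes> x \<otimes> inv g \<in> center_mod G K"
    if g: "g \<in> carrier G" and x: "x \<in> center_mod G K" for g x
  proof -
    have xG: "x \<in> carrier G" using x by (simp add: center_mod_def)
    have "commutator G h (g \<otimes> x \<otimes> inv g) \<in> K" if h: "h \<in> carrier G" for h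
    proof -
      have "commutator G h (g \<otimes> x \<otimes> inv g) = g \<otimes> commutator G (inv g \<otimes> h \<otimes> g) x \<otimes> inv g"
        using g xG h by (simp add: word_simps)
      also have "\<dots> \<in> K" using x g h by (intro normal_conj[OF K]) (auto simp: center_mod_def)
      finally show ?thesis .
    qed
    then show ?thesis using g xG by (simp add: center_mod_def)
  qed
  ultimately show ?thesis by (simp add: normal_inv_iff)
qed

lemma center_mod_pow_normal: "K \<lhd> G \<Longrightarrow> (center_mod G ^^ m) K \<lhd> G"
  by (induction m) (auto intro: center_mod_normal)

lemma center_mod_pow_incl:
  assumes "K \<lhd> G" shows "K \<subseteq> (center_mod G ^^ m) K"
proof (induction m)
  case (Suc m)
  have "x \<in> center_mod G ((center_mod G ^^ m) K)" if "x \<in> (center_mod G ^^ m) K" for x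
    using that commutator_mem_right[OF center_mod_pow_normal[OF assms]]
      subset_carrier[OF center_mod_pow_normal[OF assms]]
    by (auto simp: center_mod_def)
  then show ?case using Suc by auto
qed simp

lemma center_mod_mono: "K \<subseteq> L \<Longrightarrow> center_mod G K \<subseteq> center_mod G L"
  by (auto simp: center_mod_def)

lemma center_mod_pow_mono: "K \<subseteq> L \<Longrightarrow> (center_mod G ^^ m) K \<subseteq> (center_mod G ^^ m) L"
  by (induction m) (auto dest: center_mod_mono)

lemma commutator_center_mod_pow:
  "\<lbrakk>x \<in> (center_mod G ^^ Suc m) K; h \<in> carrier G\<rbrakk> \<Longrightarrow> commutator G h x \<in> (center_mod G ^^ m) K"
  by (simp add: center_mod_def)

section \<open>Commutator subgroups and the descending series\<close>

lemma commutator_subgroup_least: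
  assumes "subgroup K G" "\<And>a b. \<lbrakk>a \<in> A; b \<in> B\<rbrakk> \<Longrightarrow> commutator G a b \<in> K"
  shows "commutator_subgroup G A B \<subseteq> K"
  unfolding commutator_subgroup_eq by (rule generate_subgroup_incl) (use assms in auto)

lemma commutator_subgroup_incl:
  "\<lbrakk>a \<in> A; b \<in> B\<rbrakk> \<Longrightarrow> commutator G a b \<in> commutator_subgroup G A B"
  unfolding commutator_subgroup_eq by (rule generate.incl) auto

lemma commutator_subgroup_normal:
  assumes A: "A \<lhd> G" and B: "B \<lhd> G"
  shows "commutator_subgroup G A B \<lhd> G"
  unfolding commutator_subgroup_eq
proof (rule normal_generateI)
  show "{commutator G a b | a b. a \<in> A \<and> b \<in> B} \<subseteq> carrier G"
    using subset_carrier[OF A] subset_carrier[OF B] by auto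
next
  fix h g assume "h \<in> {commutator G a b | a b. a \<in> A \<and> b \<in> B}" and g: "g \<in> carrier G"
  then obtain a b where ab: "h = commutator G a b" "a \<in> A" "b \<in> B" by auto
  then have "g \<otimes> h \<otimes> inv g = commutator G (g \<otimes> a \<otimes> inv g) (g \<otimes> b \<otimes> inv g)"
    using g subset_carrier[OF A] subset_carrier[OF B] by (simp add: conj_commutator)
  then show "g \<otimes> h \<otimes> inv g \<in> {commutator G a b | a b. a \<in> A \<and> b \<in> B}"
    using ab g normal_conj[OF A] normal_conj[OF B] by blast
qed

text \<open>The induction hypothesis is used for \<open>center_mod G K\<close> in place of
  \<open>K\<close>: after \<open>m\<close> steps the descending series is central modulo
  \<open>K\<close>, and one more commutator with \<open>G\<close> falls into
  \<open>K\<close>.\<close>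

lemma rel_lower_central_le_of_center_mod_pow:
  assumes K: "K \<lhd> G" and "A \<subseteq> (center_mod G ^^ m) K"
  shows "rel_lower_central G A m \<subseteq> K"
  using assms
proof (induction m arbitrary: K)
  case (Suc m)
  have "rel_lower_central G A m \<subseteq> center_mod G K"
    by (rule Suc.IH[OF center_mod_normal]) (use Suc.prems in \<open>simp_all add: funpow_swap1\<close>)
  then show ?case
    unfolding rel_lower_central.simps
    by (intro commutator_subgroup_least normal_imp_subgroup Suc.prems(1)) (auto simp: center_mod_def)
qed simp


section \<open>Hall's nilpotency criterion\<close>

text \<open>A pointwise three subgroups lemma: \<open>[h, [a, b]]\<close> is a product of a commutator of \<open>[h, a]\<close>
  with an element of \<open>B\<close> and commutators of \<open>[h, b]\<close> with elements of \<open>A\<close>.\<close>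

lemma three_subgroups:
  assumes A: "A \<lhd> G" and B: "B \<lhd> G" and M: "subgroup M G"
    and h: "h \<in> carrier G" and a: "a \<in> A" and b: "b \<in> B"
    and ha: "\<And>b. b \<in> B \<Longrightarrow> commutator G (commutator G h a) b \<in> M"
    and hb: "\<And>a. a \<in> A \<Longrightarrow> commutator G (commutator G h b) a \<in> M"
  shows "commutator G h (commutator G a b) \<in> M"
proof -
  note carr = h subset_carrier[OF A a] subset_carrier[OF B b]
  \<comment> \<open>With \<open>c = [h, a]\<close> and \<open>b' = h b h^-1\<close> one has
    \<open>h [a, b] h^-1 = [c a, b'] = [c, y] [a, b']\<close>, which dictates this
    \<open>y\<close>.\<close>
  define y where "y = a \<otimes> (h \<otimes> b \<otimes> inv h) \<otimes> inv a"
  have "commutator G h (commutator G a b) =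
      commutator G (commutator G h a) y \<otimes> inv (commutator G (commutator G h b) a)
        \<otimes> commutator G (commutator G h b) (commutator G a b)"
    unfolding y_def using carr by (simp add: word_simps)
  moreover have "y \<in> B" unfolding y_def using carr b by (intro normal_conj[OF B])
  moreover have "commutator G a b \<in> A" using commutator_mem_left[OF A a] carr by simp
  ultimately show ?thesis
    using ha hb a M by (simp add: subgroup.m_closed subgroup.m_inv_closed)
qed

text \<open>Modulo \<open>K\<close> the commutator behaves like a bilinear map on
  \<open>A/A'\<close> and \<open>B/B'\<close>, so the numbers of steps in which \<open>G\<close>
  acts nilpotently add up. By \<open>three_subgroups\<close>, \<open>[h, [a, b]]\<close> reduces to
  commutators in which \<open>i\<close> or \<open>j\<close> has dropped by one; when either is 0,
  \<open>A'B\<close> or \<open>AB'\<close> applies.\<close>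

lemma commutator_center_mod_pow_add:
  assumes A: "A \<lhd> G" and B: "B \<lhd> G" and A': "A' \<lhd> G" and B': "B' \<lhd> G" and K: "K \<lhd> G"
    and A'B: "\<And>a b. \<lbrakk>a \<in> A'; b \<in> B\<rbrakk> \<Longrightarrow> commutator G a b \<in> K"
    and AB': "\<And>a b. \<lbrakk>a \<in> A; b \<in> B'\<rbrakk> \<Longrightarrow> commutator G a b \<in> K"
    and "a \<in> A \<inter> (center_mod G ^^ i) A'" "b \<in> B \<inter> (center_mod G ^^ j) B'"
  shows "commutator G a b \<in> (center_mod G ^^ (i + j)) K"
  using assms(8,9)
proof (induction "i + j" arbitrary: i j a b rule: less_induct)
  case less
  show ?case
  proof (cases "i = 0 \<or> j = 0")
    case True
    then have "commutator G a b \<in> K" using less.prems A'B AB' by auto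
    then show ?thesis using center_mod_pow_incl[OF K] by blast
  next
    case False
    then obtain i' j' where ij: "i = Suc i'" "j = Suc j'" by (meson not0_implies_Suc)
    have nA: "A \<inter> (center_mod G ^^ i) A' \<lhd> G" and nB: "B \<inter> (center_mod G ^^ j) B' \<lhd> G"
      using A A' B B' center_mod_pow_normal normal_subgroup_intersect by auto
    note M = center_mod_pow_normal[OF K, of "Suc (i' + j')"]
    have "commutator G h (commutator G a b) \<in> (center_mod G ^^ Suc (i' + j')) K"
      if h: "h \<in> carrier G" for h
    proof (rule three_subgroups[OF nA nB normal_imp_subgroup[OF M] h less.prems])
      fix b' assume b': "b' \<in> B \<inter> (center_mod G ^^ j) B'"
      have "commutator G h a \<in> A \<inter> (center_mod G ^^ i') A'"
        using less.prems(1) h ij commutator_mem_right[OF A]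
          commutator_center_mod_pow[of a i'] by blast
      from less.hyps[OF _ this b'] show "commutator G (commutator G h a) b'
          \<in> (center_mod G ^^ Suc (i' + j')) K" using ij by simp
    next
      fix a' assume a': "a' \<in> A \<inter> (center_mod G ^^ i) A'"
      have hb: "commutator G h b \<in> B \<inter> (center_mod G ^^ j') B'"
        using less.prems(2) h ij commutator_mem_right[OF B]
          commutator_center_mod_pow[of b j'] by blast
      from less.hyps[OF _ a' this] have "commutator G a' (commutator G h b)
          \<in> (center_mod G ^^ Suc (i' + j')) K" using ij by simp
      then show "commutator G (commutator G h b) a' \<in> (center_mod G ^^ Suc (i' + j')) K"
        using commutator_swap_mem[OF normal_imp_subgroup[OF M]] a' hb
          subset_carrier[OF A] subset_carrier[OF B] by blast
    qed
    moreover have "commutator G a b \<in> carrier G"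
      using less.prems subset_carrier[OF A] subset_carrier[OF B] by auto
    ultimately show ?thesis using ij by (simp add: center_mod_def)
  qed
qed

section \<open>Along the lower central series of \<open>N\<close>\<close>

text \<open>The series of \<open>N\<close> is formed inside \<open>G\<close>, not inside the
  restricted group, so that normality in \<open>G\<close> makes sense for its terms. Indices start
  at 0, hence \<open>[N, N]\<close> has index 1.\<close>

primrec lower_central :: "'a set \<Rightarrow> nat \<Rightarrow> 'a set" where
  "lower_central N 0 = N"
| "lower_central N (Suc i) = commutator_subgroup G N (lower_central N i)"

lemma lower_central_normal: "N \<lhd> G \<Longrightarrow> lower_central N i \<lhd> G"
  by (induction i) (auto intro: commutator_subgroup_normal)

text \<open>Inverses and generated subgroups agree in \<open>N\<close> and in \<open>G\<close>. The
  inclusion in \<open>N\<close> is carried along because the induction needs it for this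
  comparison.\<close>

lemma rel_lower_central_restrict:
  assumes N: "N \<lhd> G"
  shows "rel_lower_central (G\<lparr>carrier := N\<rparr>) N i = lower_central N i \<and> lower_central N i \<subseteq> N"
proof (induction i)
  case (Suc i)
  note sN = normal_imp_subgroup[OF N]
  have "commutator (G\<lparr>carrier := N\<rparr>) a b = commutator G a b"
    if "a \<in> N" "b \<in> lower_central N i" for a b
    using that Suc m_inv_consistent[OF sN] by (simp add: commutator_def subset_iff)
  then have "{commutator (G\<lparr>carrier := N\<rparr>) a b | a b. a \<in> N \<and> b \<in> lower_central N i}
      = {commutator G a b | a b. a \<in> N \<and> b \<in> lower_central N i}"
    by (metis (lifting))
  moreover have sub: "{commutator G a b | a b. a \<in> N \<and> b \<in> lower_central N i} \<subseteq> N"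
    using commutator_mem_left[OF N] Suc subset_carrier[OF N] by blast
  moreover have "lower_central N (Suc i) \<subseteq> N"
    using generate_subgroup_incl[OF sub sN] by (simp add: commutator_subgroup_eq)
  ultimately show ?case
    using Suc generate_consistent[OF sub sN] by (simp add: commutator_subgroup_eq)
qed simp

text \<open>For \<open>x = [a, b]\<close>, commuting \<open>y\<close> with one of \<open>a\<close>,
  \<open>b\<close> and then with the other raises the index by one each time, so
  \<open>three_subgroups\<close> with \<open>h = y\<close> gives the claim on generators.\<close>

lemma commutator_lower_central_1:
  assumes N: "N \<lhd> G" and x: "x \<in> lower_central N 1" and y: "y \<in> lower_central N i"
  shows "commutator G x y \<in> lower_central N (Suc (Suc i))"
proof -
  note L = lower_central_normal[OF N]
  have yG: "y \<in> carrier G" using subset_carrier[OF L y] .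
  have *: "commutator G (commutator G y a) b \<in> lower_central N (Suc (Suc i))"
    if "a \<in> N" "b \<in> N" for a b
  proof -
    have "commutator G a y \<in> lower_central N (Suc i)"
      using commutator_subgroup_incl[OF that(1) y] by simp
    then have ya: "commutator G y a \<in> lower_central N (Suc i)"
      using commutator_swap_mem[OF normal_imp_subgroup[OF L]] yG subset_carrier[OF N that(1)] by blast
    then have "commutator G b (commutator G y a) \<in> lower_central N (Suc (Suc i))"
      using commutator_subgroup_incl[OF that(2) ya] by simp
    then show ?thesis
      using commutator_swap_mem[OF normal_imp_subgroup[OF L]] subset_carrier[OF N that(2)]
        subset_carrier[OF L ya] by blast
  qed
  have "commutator_subgroup G N N
      \<subseteq> {x \<in> carrier G. commutator G y x \<in> lower_central N (Suc (Suc i))}"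
  proof (rule commutator_subgroup_least[OF subgroup_commutator_right[OF L yG]])
    fix a b assume ab: "a \<in> N" "b \<in> N"
    then have "commutator G y (commutator G a b) \<in> lower_central N (Suc (Suc i))"
      by (rule three_subgroups[OF N N normal_imp_subgroup[OF L] yG]) (use ab * in blast)+
    then show "commutator G a b
        \<in> {x \<in> carrier G. commutator G y x \<in> lower_central N (Suc (Suc i))}"
      using ab subset_carrier[OF N] by (simp del: lower_central.simps)
  qed
  then have "x \<in> carrier G" "commutator G y x \<in> lower_central N (Suc (Suc i))"
    using x by auto
  then show ?thesis
    by (rule commutator_swap_mem[OF normal_imp_subgroup[OF L] yG])
qed

text \<open>Each factor of the series is generated by commutators from \<open>N/[N, N]\<close> and
  the preceding factor. Nilpotency of the action therefore propagates by
  \<open>commutator_center_mod_pow_add\<close>, at the cost of \<open>m\<close> further steps per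
  factor.\<close>

lemma lower_central_le_center_mod_pow:
  assumes N: "N \<lhd> G" and m: "N \<subseteq> (center_mod G ^^ m) (lower_central N 1)"
  shows "\<exists>k. lower_central N i \<subseteq> (center_mod G ^^ k) (lower_central N (Suc i))"
proof (induction i)
  case 0
  then show ?case using m by auto
next
  case (Suc i)
  note L = lower_central_normal[OF N]
  obtain k where k: "lower_central N i \<subseteq> (center_mod G ^^ k) (lower_central N (Suc i))"
    using Suc by blast
  have "commutator G a b \<in> (center_mod G ^^ (m + k)) (lower_central N (Suc (Suc i)))"
    if "a \<in> N" "b \<in> lower_central N i" for a b
  proof (rule commutator_center_mod_pow_add[OF N L[of i] L[of 1] L[of "Suc i"] L[of "Suc (Suc i)"]])
    show "commutator G a b \<in> lower_central N (Suc (Suc i))"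
      if "a \<in> N" "b \<in> lower_central N (Suc i)" for a b
      using commutator_subgroup_incl[OF that] by simp
  qed (use that m k commutator_lower_central_1[OF N] in auto)
  then have "lower_central N (Suc i) \<subseteq> (center_mod G ^^ (m + k)) (lower_central N (Suc (Suc i)))"
    unfolding lower_central.simps(2)[of N i]
    by (intro commutator_subgroup_least normal_imp_subgroup center_mod_pow_normal L)
  then show ?case by blast
qed

text \<open>The numbers of steps for the successive factors are added up, which works because
  iterates of \<open>center_mod\<close> are monotone in \<open>K\<close>.\<close>

lemma Hall_center_mod_pow:
  assumes N: "N \<lhd> G" and m: "N \<subseteq> (center_mod G ^^ m) (lower_central N 1)"
  shows "\<exists>k. N \<subseteq> (center_mod G ^^ k) (lower_central N i)"
proof (induction i)
  case 0
  show ?case by (intro exI[of _ 0]) simp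
next
  case (Suc i)
  then obtain k where k: "N \<subseteq> (center_mod G ^^ k) (lower_central N i)" by blast
  obtain l where "lower_central N i \<subseteq> (center_mod G ^^ l) (lower_central N (Suc i))"
    using lower_central_le_center_mod_pow[OF assms] by blast
  with k have "N \<subseteq> (center_mod G ^^ (k + l)) (lower_central N (Suc i))"
    using center_mod_pow_mono[of "lower_central N i" _ k] by (simp add: funpow_add) blast
  then show ?case by blast
qed


section \<open>Quadratically unipotent generators\<close>

text \<open>\<open>G\<close> acts on \<open>N\<close> modulo \<open>K\<close> through the abelian
  group \<open>G/N\<close>, so \<open>s\<close> preserves the elements fixed by
  \<open>t\<close>.\<close>

lemma commutator_commutator_mem:
  assumes K: "K \<lhd> G" and N: "N \<lhd> G"
    and GN: "\<And>g h. \<lbrakk>g \<in> carrier G; h \<in> carrier G\<rbrakk> \<Longrightarrow> commutator G g h \<in> N"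
    and NK: "\<And>a b. \<lbrakk>a \<in> N; b \<in> N\<rbrakk> \<Longrightarrow> commutator G a b \<in> K"
    and s: "s \<in> carrier G" and t: "t \<in> carrier G" and n: "n \<in> N" and tn: "commutator G t n \<in> K"
  shows "commutator G t (commutator G s n) \<in> K"
proof -
  have nG: "n \<in> carrier G" using subset_carrier[OF N n] .
  note L = subgroup_commutator_left[OF K nG] and R = subgroup_commutator_right[OF K t]
  \<comment> \<open>The conjugate \<open>s^-1 t s\<close> equals \<open>[s^-1, t] t\<close>. The
    first factor lies in \<open>N\<close> and the second fixes \<open>n\<close> modulo
    \<open>K\<close>, so the conjugate fixes \<open>n\<close> as well.\<close>
  have "commutator G (inv s) t \<in> {g \<in> carrier G. commutator G g n \<in> K}"
    using NK[OF GN n] s t by simp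
  then have "commutator G (inv s) t \<otimes> t \<in> {g \<in> carrier G. commutator G g n \<in> K}"
    by (rule subgroup.m_closed[OF L]) (use t tn in simp)
  moreover have "commutator G (inv s) t \<otimes> t = inv s \<otimes> t \<otimes> s"
    using s t by (simp add: word_simps)
  ultimately have "commutator G (inv s \<otimes> t \<otimes> s) n \<in> K" by simp
  moreover have "s \<otimes> commutator G (inv s \<otimes> t \<otimes> s) n \<otimes> inv s = commutator G t (s \<otimes> n \<otimes> inv s)"
    using s t nG by (simp add: word_simps)
  ultimately have "commutator G t (s \<otimes> n \<otimes> inv s) \<in> K"
    using normal_conj[OF K s] by metis
  \<comment> \<open>The commutator \<open>[s, n]\<close> is the product of \<open>s n s^-1\<close>
    and \<open>n^-1\<close>, both centralized by \<open>t\<close> modulo \<open>K\<close>.\<close>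
  then have "s \<otimes> n \<otimes> inv s \<otimes> inv n \<in> {x \<in> carrier G. commutator G t x \<in> K}"
    using s nG tn subgroup.m_closed[OF R, of "s \<otimes> n \<otimes> inv s" "inv n"]
      subgroup.m_inv_closed[OF R, of n]
    by simp
  then show ?thesis by (simp add: commutator_def[of G s n])
qed

text \<open>Commuting operators that are each quadratically unipotent generate a nilpotent action.
  The generators are handled one at a time, each doubling the exponent, so the induction produces
  \<open>m = 2 ^ card S\<close>.\<close>

lemma center_mod_pow_of_quadratic:
  assumes N: "N \<lhd> G"
    and GN: "\<And>g h. \<lbrakk>g \<in> carrier G; h \<in> carrier G\<rbrakk> \<Longrightarrow> commutator G g h \<in> N"
    and S: "finite S" "S \<subseteq> carrier G" and gen: "carrier G \<subseteq> generate G (N \<union> S)"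
    and quad: "\<And>s n. \<lbrakk>s \<in> S; n \<in> N\<rbrakk> \<Longrightarrow> commutator G s (commutator G s n) = \<one>"
    and K: "K \<lhd> G" and NK: "\<And>a b. \<lbrakk>a \<in> N; b \<in> N\<rbrakk> \<Longrightarrow> commutator G a b \<in> K"
  shows "\<exists>m. N \<subseteq> (center_mod G ^^ m) K"
proof -
  \<comment> \<open>\<open>F\<close> collects the generators not yet assumed to fix \<open>n\<close>
    modulo \<open>K\<close>. The bound \<open>m\<close> must be uniform in \<open>K\<close> and
    \<open>n\<close>, since the induction changes both.\<close>
  have "\<exists>m. \<forall>K n. K \<lhd> G \<and> (\<forall>a\<in>N. \<forall>b\<in>N. commutator G a b \<in> K) \<and> n \<in> N \<and>
      (\<forall>s\<in>S - F. commutator G s n \<in> K) \<longrightarrow> n \<in> (center_mod G ^^ m) K"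
    if "finite F" "F \<subseteq> S" for F
    using that
  proof (induction F rule: finite_induct)
    case empty
    have "n \<in> (center_mod G ^^ 1) K"
      if K: "K \<lhd> G" and NK: "\<forall>a\<in>N. \<forall>b\<in>N. commutator G a b \<in> K" and n: "n \<in> N"
        and Sn: "\<forall>s\<in>S. commutator G s n \<in> K" for K n
    proof -
      \<comment> \<open>With \<open>F\<close> empty, both \<open>S\<close> and \<open>N\<close>
        centralize \<open>n\<close> modulo \<open>K\<close>, hence so does the group they
        generate.\<close>
      have "generate G (N \<union> S) \<subseteq> {g \<in> carrier G. commutator G g n \<in> K}"
        using S(2) NK Sn n subset_carrier[OF N]
        by (intro generate_subgroup_incl subgroup_commutator_left K) auto
      then show ?thesis using gen subset_carrier[OF N n] by (auto simp: center_mod_def)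
    qed
    then show ?case by (intro exI[of _ 1]) simp
  next
    case (insert s F)
    \<comment> \<open>\<open>[s, n]\<close> is fixed by \<open>s\<close> modulo \<open>K\<close>, so the hypothesis for \<open>F\<close> applies to it, and then,
      modulo \<open>(center_mod G ^^ m) K\<close>, to \<open>n\<close> itself.\<close>
    then obtain m where "\<forall>K n. K \<lhd> G \<and> (\<forall>a\<in>N. \<forall>b\<in>N. commutator G a b \<in> K) \<and> n \<in> N \<and>
      (\<forall>s\<in>S - F. commutator G s n \<in> K) \<longrightarrow> n \<in> (center_mod G ^^ m) K" by auto
    then have m: "n \<in> (center_mod G ^^ m) K"
      if "K \<lhd> G" "\<And>a b. \<lbrakk>a \<in> N; b \<in> N\<rbrakk> \<Longrightarrow> commutator G a b \<in> K" "n \<in> N"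
        "\<And>t. t \<in> S - F \<Longrightarrow> commutator G t n \<in> K" for K n
      using that by blast
    have s: "s \<in> S" "s \<in> carrier G" using insert.prems S by auto
    have "n \<in> (center_mod G ^^ (m + m)) K"
      if K: "K \<lhd> G" and NK: "\<And>a b. \<lbrakk>a \<in> N; b \<in> N\<rbrakk> \<Longrightarrow> commutator G a b \<in> K" and n: "n \<in> N"
        and Sn: "\<And>t. t \<in> S - insert s F \<Longrightarrow> commutator G t n \<in> K" for K n
    proof -
      let ?Z = "(center_mod G ^^ m) K"
      have KZ: "K \<subseteq> ?Z" by (rule center_mod_pow_incl[OF K])
      have "commutator G s n \<in> ?Z"
      proof (rule m[OF K NK])
        show "commutator G s n \<in> N" by (rule commutator_mem_right[OF N s(2) n])
        fix t assume t: "t \<in> S - F"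
        show "commutator G t (commutator G s n) \<in> K"
        proof (cases "t = s")
          case True
          then show ?thesis
            using quad[OF s(1) n] subgroup.one_closed[OF normal_imp_subgroup[OF K]] by simp
        next
          case False
          then show ?thesis
            using t S by (intro commutator_commutator_mem[OF K N GN NK s(2) _ n] Sn) auto
        qed
      qed
      then have "n \<in> (center_mod G ^^ m) ?Z"
        using KZ NK Sn by (intro m[OF center_mod_pow_normal[OF K] _ n]) blast+
      then show ?thesis by (simp add: funpow_add)
    qed
    then show ?case by (intro exI[of _ "m + m"]) blast
  qed
  from this[OF S(1) order_refl] show ?thesis using K NK by simp blast
qed

theorem rel_lower_central_trivial:
  assumes N: "N \<lhd> G" and nil: "nilpotent_group (G\<lparr>carrier := N\<rparr>)"
    and GN: "\<And>g h. \<lbrakk>g \<in> carrier G; h \<in> carrier G\<rbrakk> \<Longrightarrow> commutator G g h \<in> N"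
    and S: "finite S" "S \<subseteq> carrier G" "carrier G \<subseteq> generate G (N \<union> S)"
    and quad: "\<And>s n. \<lbrakk>s \<in> S; n \<in> N\<rbrakk> \<Longrightarrow> commutator G s (commutator G s n) = \<one>"
  shows "\<exists>c. rel_lower_central G N c = {\<one>}"
proof -
  obtain c where c: "lower_central N c = {\<one>}"
    using nil rel_lower_central_restrict[OF N] by (auto simp: nilpotent_group_def)
  obtain m where m: "N \<subseteq> (center_mod G ^^ m) (lower_central N 1)"
    using center_mod_pow_of_quadratic[OF N GN S quad lower_central_normal[OF N, of 1]]
      commutator_subgroup_incl[of _ N _ N] by auto
  then obtain k where k: "N \<subseteq> (center_mod G ^^ k) {\<one>}"
    using Hall_center_mod_pow[OF N m, of c] c by auto
  have "rel_lower_central G N k \<subseteq> {\<one>}"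
    by (rule rel_lower_central_le_of_center_mod_pow[OF one_is_normal k])
  moreover have "\<one> \<in> rel_lower_central G N k"
    using subgroup.one_closed[OF normal_imp_subgroup[OF N]] generate.one
    by (cases k) (auto simp: commutator_subgroup_def)
  ultimately show ?thesis by blast
qed

end


section \<open>Quandles\<close>

lemma (in quandle) sym_map_conj:
  assumes \<phi>: "\<phi> \<in> carrier (Inn Q)" and x: "x \<in> carrier Q"
  shows "\<phi> \<otimes>\<^bsub>Inn Q\<^esub> sym_map Q x \<otimes>\<^bsub>Inn Q\<^esub> inv\<^bsub>Inn Q\<^esub> \<phi> = sym_map Q (\<phi> x)"
proof -
  interpret I: group "Inn Q" by (rule group_Inn)
  have hom: "\<phi> \<in> quandle_hom Q Q" using Inn_sub_Aut \<phi> by (auto simp: quandle_Aut_def)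
  then have \<phi>x: "\<phi> x \<in> carrier Q" using x by (auto simp: quandle_hom_def)
  have "compose (carrier Q) \<phi> (sym_map Q x) = compose (carrier Q) (sym_map Q (\<phi> x)) \<phi>"
    using hom x by (intro ext) (auto simp: quandle_hom_def compose_def sym_map_def symm_closed)
  then have "\<phi> \<otimes>\<^bsub>Inn Q\<^esub> sym_map Q x = sym_map Q (\<phi> x) \<otimes>\<^bsub>Inn Q\<^esub> \<phi>"
    using \<phi> x \<phi>x by (simp add: Inn_mult sym_map_Inn)
  then show ?thesis using \<phi> \<phi>x by (simp add: I.m_assoc sym_map_Inn)
qed

text \<open>One representative \<open>a\<close> per component suffices: if
  \<open>x = \<phi> a\<close>, then \<open>sym_map Q x\<close> is the conjugate of
  \<open>sym_map Q a\<close> by \<open>\<phi>\<close>, which differs from \<open>sym_map Q a\<close>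
  only by a commutator, an element of \<open>N\<close>.\<close>

lemma (in quandle) carrier_Inn_le_generate:
  assumes N: "N \<lhd> Inn Q"
    and GN: "\<And>g h. \<lbrakk>g \<in> carrier (Inn Q); h \<in> carrier (Inn Q)\<rbrakk> \<Longrightarrow> commutator (Inn Q) g h \<in> N"
    and fin: "finite (connected_components Q)"
  shows "\<exists>A. finite A \<and> A \<subseteq> carrier Q \<and> carrier (Inn Q) \<subseteq> generate (Inn Q) (N \<union> sym_map Q ` A)"
proof -
  interpret I: group "Inn Q" by (rule group_Inn)
  define orb where "orb = (\<lambda>x. orbit (Inn Q) (\<lambda>\<phi>. \<phi>) x)"
  have "connected_components Q = orb ` carrier Q"
    by (auto simp: connected_components_def orbits_def orb_def)
  then obtain A where A: "finite A" "A \<subseteq> carrier Q" "orb ` carrier Q = orb ` A"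
    using fin finite_subset_image[of "orb ` carrier Q" orb "carrier Q"] by auto
  let ?H = "generate (Inn Q) (N \<union> sym_map Q ` A)"
  have sub: "N \<union> sym_map Q ` A \<subseteq> carrier (Inn Q)"
    using A(2) sym_map_Inn I.subset_carrier[OF N] by auto
  have H: "subgroup ?H (Inn Q)" by (rule I.generate_is_subgroup[OF sub])
  have "sym_map Q x \<in> ?H" if x: "x \<in> carrier Q" for x
  proof -
    obtain a where a: "a \<in> A" "orb x = orb a" using A(3) x by blast
    have "x = \<one>\<^bsub>Inn Q\<^esub> x" using x by (simp add: Inn_one)
    then have "x \<in> orb x" using I.one_closed unfolding orb_def orbit_def by blast
    then obtain \<phi> where \<phi>: "\<phi> \<in> carrier (Inn Q)" "x = \<phi> a"
      using a(2) by (auto simp: orb_def orbit_def)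
    have aQ: "a \<in> carrier Q" using a A by auto
    have "sym_map Q x = commutator (Inn Q) \<phi> (sym_map Q a) \<otimes>\<^bsub>Inn Q\<^esub> sym_map Q a"
      using sym_map_conj[OF \<phi>(1) aQ] \<phi> sym_map_Inn[OF aQ] sym_map_Inn[OF x]
      by (simp add: commutator_def I.m_assoc[of "sym_map Q (\<phi> a)"])
    then show ?thesis
      using GN[OF \<phi>(1) sym_map_Inn[OF aQ]] a(1)
      by (simp only:) (intro subgroup.m_closed[OF H] generate.incl; simp)
  qed
  then have "generate (Inn Q) (sym_map Q ` carrier Q) \<subseteq> ?H"
    by (intro I.generate_subgroup_incl H) auto
  then show ?thesis using A Inn_generate by auto
qed

theorem corollary0p7:
  fixes P :: "('a, 'p) quandle_scheme" and Q :: "('b, 'q) quandle_scheme" and f :: "'a \<Rightarrow> 'b"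
  assumes "quandle P" and "quandle Q"
    and "operator_reduced P Q f"
    and "(\<exists>A. finite A \<and> A \<subseteq> carrier P \<and> carrier (Inn P) = generate (Inn P) (sym_map P ` A))
         \<or> finite (connected_components P)"
    and "nilpotent_group ((Inn P)\<lparr>carrier := Inn_rel P Q f\<rparr>)"
    and "comm_group (Inn Q)"
  shows "nilpotent_quandle_hom P Q f"
proof -
  interpret P: quandle P by fact
  interpret Q: quandle Q by fact
  interpret G: group "Inn P" by (rule P.group_Inn)
  interpret H: comm_group "Inn Q" by fact
  have f: "f \<in> quandle_epi P Q" using assms(3) by (simp add: operator_reduced_def)
  interpret h: group_hom "Inn P" "Inn Q" "Inn_map P Q f"
    by (intro group_hom.intro group_hom_axioms.intro G.is_group H.is_group
        Inn_map(1)[OF assms(1,2) f])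
  let ?N = "Inn_rel P Q f"
  have N: "?N \<lhd> Inn P" unfolding Inn_rel_def by (rule h.normal_kernel)
  have GN: "commutator (Inn P) a b \<in> ?N" if "a \<in> carrier (Inn P)" "b \<in> carrier (Inn P)" for a b
  proof -
    have "Inn_map P Q f (commutator (Inn P) a b)
        = commutator (Inn Q) (Inn_map P Q f a) (Inn_map P Q f b)"
      using that by (simp add: commutator_def)
    also have "\<dots> = \<one>\<^bsub>Inn Q\<^esub>"
      using that H.m_comm[of "Inn_map P Q f a" "Inn_map P Q f b"]
      by (simp add: commutator_def H.m_assoc H.inv_cancel_left)
    finally show ?thesis using that by (simp add: Inn_rel_def kernel_def)
  qed
  \<comment> \<open>In the finitely generated case, adjoining \<open>N\<close> to the generators can
    only enlarge the generated subgroup; the other case is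
    \<open>carrier_Inn_le_generate\<close>.\<close>
  obtain A where A: "finite A" "A \<subseteq> carrier P"
    "carrier (Inn P) \<subseteq> generate (Inn P) (?N \<union> sym_map P ` A)"
    using assms(4) P.carrier_Inn_le_generate[OF N GN]
      G.mono_generate[of "sym_map P ` _" "?N \<union> sym_map P ` _"] by (metis Un_upper2)
  have "commutator (Inn P) s (commutator (Inn P) s n) = \<one>\<^bsub>Inn P\<^esub>"
    if sA: "s \<in> sym_map P ` A" and n: "n \<in> ?N" for s n
  proof -
    obtain x where x: "x \<in> carrier P" "s = sym_map P x" using sA A(2) by auto
    have nG: "n \<in> carrier (Inn P)" by (rule G.subset_carrier[OF N n])
    have s: "s \<in> carrier (Inn P)" using x P.sym_map_Inn by simp
    \<comment> \<open>This \<open>t\<close> is the symmetry map at \<open>n x\<close>, so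
      operator-reducedness makes it commute with \<open>s\<close>. As
      \<open>[s, n] = s t^-1\<close>, also \<open>s\<close> commutes with
      \<open>[s, n]\<close>.\<close>
    define t where "t = n \<otimes>\<^bsub>Inn P\<^esub> s \<otimes>\<^bsub>Inn P\<^esub> inv\<^bsub>Inn P\<^esub> n"
    have t: "t \<in> carrier (Inn P)" using s nG by (simp add: t_def)
    have "s \<otimes>\<^bsub>Inn P\<^esub> t = t \<otimes>\<^bsub>Inn P\<^esub> s"
      using assms(3) x n P.sym_map_conj[OF nG x(1)] by (auto simp: operator_reduced_def t_def)
    then have "inv\<^bsub>Inn P\<^esub> t \<otimes>\<^bsub>Inn P\<^esub> s = s \<otimes>\<^bsub>Inn P\<^esub> inv\<^bsub>Inn P\<^esub> t"
      using s t by (metis G.inv_closed G.inv_cancel_left(2) G.m_assoc G.m_closed G.r_inv G.r_one)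
    then have "s \<otimes>\<^bsub>Inn P\<^esub> (s \<otimes>\<^bsub>Inn P\<^esub> inv\<^bsub>Inn P\<^esub> t) = s \<otimes>\<^bsub>Inn P\<^esub> inv\<^bsub>Inn P\<^esub> t \<otimes>\<^bsub>Inn P\<^esub> s"
      using s t by (simp add: G.m_assoc)
    moreover have sn: "commutator (Inn P) s n = s \<otimes>\<^bsub>Inn P\<^esub> inv\<^bsub>Inn P\<^esub> t"
      using s nG by (simp add: t_def G.word_simps)
    ultimately show ?thesis
      unfolding sn commutator_def[of _ s "s \<otimes>\<^bsub>Inn P\<^esub> inv\<^bsub>Inn P\<^esub> t"]
      using s t
      by (simp only:) (simp add: G.m_assoc G.inv_mult_group G.inv_cancel_left)
  qed
  then have "\<exists>c. rel_lower_central (Inn P) ?N c = {\<one>\<^bsub>Inn P\<^esub>}"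
    using A P.sym_map_Inn by (intro G.rel_lower_central_trivial[OF N assms(5) GN,
        of "sym_map P ` A"]) auto
  then show ?thesis using f by (simp add: nilpotent_quandle_hom_def)
qed

end
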